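(* If $2 < n < \aleph_0$, then $\textup{deg}(\mathsf{BW}_n) = 2^{\aleph_0}$.
   Context: Si-logics are sets of intuitionistic formulas containing $\mathsf{IPC}$ closed under modus ponens and substitution. For $n<\aleph_0$, $\mathsf{bw}_n = \bigvee_{i=0}^{n}\big(p_i \to \bigvee_{j\neq i} p_j\big)$ and $\mathsf{BW}_n = \mathsf{IPC}+\mathsf{bw}_n$ (the least si-logic containing $\mathsf{bw}_n$). Formulas are interpreted in posets with upset valuations; $\mathsf{Fin}(\mathsf{L})$ is the class of finite posets validating $\mathsf{L}$, and $\textup{deg}(\mathsf{L})$ is the cardinality of the set of si-logics $\mathsf{L}'$ with $\mathsf{Fin}(\mathsf{L}')=\mathsf{Fin}(\mathsf{L})$. *)

theory Defs
  imports Main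
begin

unbundle cardinal_syntax

section \<open>Formulas and si-logics\<close>

datatype fm =
    Var nat
  | Bot
  | And fm fm
  | Or fm fm
  | Imp fm fm

primrec fsubst :: "(nat \<Rightarrow> fm) \<Rightarrow> fm \<Rightarrow> fm" where
  "fsubst \<sigma> (Var p) = \<sigma> p"
| "fsubst \<sigma> Bot = Bot"
| "fsubst \<sigma> (And A B) = And (fsubst \<sigma> A) (fsubst \<sigma> B)"
| "fsubst \<sigma> (Or A B) = Or (fsubst \<sigma> A) (fsubst \<sigma> B)"
| "fsubst \<sigma> (Imp A B) = Imp (fsubst \<sigma> A) (fsubst \<sigma> B)"

inductive_set IPC :: "fm set" where
  K: "Imp A (Imp B A) \<in> IPC"
| S: "Imp (Imp A (Imp B C)) (Imp (Imp A B) (Imp A C)) \<in> IPC"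
| andI: "Imp A (Imp B (And A B)) \<in> IPC"
| andE1: "Imp (And A B) A \<in> IPC"
| andE2: "Imp (And A B) B \<in> IPC"
| orI1: "Imp A (Or A B) \<in> IPC"
| orI2: "Imp B (Or A B) \<in> IPC"
| orE: "Imp (Imp A C) (Imp (Imp B C) (Imp (Or A B) C)) \<in> IPC"
| botE: "Imp Bot A \<in> IPC"
| mp: "Imp A B \<in> IPC \<Longrightarrow> A \<in> IPC \<Longrightarrow> B \<in> IPC"

definition si_logic :: "fm set \<Rightarrow> bool" where
  "si_logic L \<longleftrightarrow> IPC \<subseteq> L
     \<and> (\<forall>A B. Imp A B \<in> L \<longrightarrow> A \<in> L \<longrightarrow> B \<in> L)
     \<and> (\<forall>\<sigma> A. A \<in> L \<longrightarrow> fsubst \<sigma> A \<in> L)"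

definition IPC_plus :: "fm \<Rightarrow> fm set" where
  "IPC_plus A = \<Inter> {L. si_logic L \<and> A \<in> L}"

fun disj :: "fm list \<Rightarrow> fm" where
  "disj [] = Bot"
| "disj [A] = A"
| "disj (A # B # As) = Or A (disj (B # As))"

definition bw :: "nat \<Rightarrow> fm" where
  "bw n = disj (map (\<lambda>i. Imp (Var i) (disj (map Var (filter (\<lambda>j. j \<noteq> i) [0..<Suc n]))))
                    [0..<Suc n])"

definition BW :: "nat \<Rightarrow> fm set" where
  "BW n = IPC_plus (bw n)"


section \<open>Kripke semantics\<close>

text \<open>A poset is a pair of a carrier and an order on it; \<open>(x, y) \<in> R\<close> means \<open>x \<le> y\<close>.\<close>

type_synonym 'a frame = "'a set \<times> 'a rel"

definition is_poset :: "'a frame \<Rightarrow> bool" where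
  "is_poset F \<longleftrightarrow> (case F of (W, R) \<Rightarrow> partial_order_on W R)"

definition upset :: "'a frame \<Rightarrow> 'a set \<Rightarrow> bool" where
  "upset F U \<longleftrightarrow> (case F of (W, R) \<Rightarrow>
     U \<subseteq> W \<and> (\<forall>x y. x \<in> U \<longrightarrow> (x, y) \<in> R \<longrightarrow> y \<in> U))"

primrec forces :: "'a frame \<Rightarrow> (nat \<Rightarrow> 'a set) \<Rightarrow> 'a \<Rightarrow> fm \<Rightarrow> bool" where
  "forces F V x (Var p) \<longleftrightarrow> x \<in> V p"
| "forces F V x Bot \<longleftrightarrow> False"
| "forces F V x (And A B) \<longleftrightarrow> forces F V x A \<and> forces F V x B"
| "forces F V x (Or A B) \<longleftrightarrow> forces F V x A \<or> forces F V x B"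
| "forces F V x (Imp A B) \<longleftrightarrow>
     (\<forall>y \<in> fst F. (x, y) \<in> snd F \<longrightarrow> forces F V y A \<longrightarrow> forces F V y B)"

definition valid :: "'a frame \<Rightarrow> fm \<Rightarrow> bool" where
  "valid F A \<longleftrightarrow> (\<forall>V. (\<forall>p. upset F (V p)) \<longrightarrow> (\<forall>x \<in> fst F. forces F V x A))"

definition validates :: "'a frame \<Rightarrow> fm set \<Rightarrow> bool" where
  "validates F L \<longleftrightarrow> (\<forall>A \<in> L. valid F A)"

text \<open>
  The finite posets are represented by those whose carrier is a finite set of natural
  numbers. Up to isomorphism these are all finite posets, and validity is invariant under
  isomorphism, so \<open>Fin L = Fin L'\<close> expresses that \<open>L\<close> and \<open>L'\<close> have the same finite posets
  over every type; see \<open>Fin_eq_imp_validates_iff\<close> below.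
\<close>

definition Fin :: "fm set \<Rightarrow> nat frame set" where
  "Fin L = {F. is_poset F \<and> finite (fst F) \<and> validates F L}"

text \<open>The degree is a cardinal in the sense of the library, to be compared by \<open>=o\<close>.\<close>

definition deg :: "fm set \<Rightarrow> fm set rel" where
  "deg L = |{L'. si_logic L' \<and> Fin L' = Fin L}|"


section \<open>Independence of the carrier type\<close>

lemma valid_transfer:
  fixes f :: "'a \<Rightarrow> 'b" and W :: "'a set" and R :: "'a rel"
  assumes inj: "inj_on f W" and R: "R \<subseteq> W \<times> W"
    and v: "valid (f ` W, map_prod f f ` R) A"
  shows "valid (W, R) A"
  unfolding valid_def
proof (intro allI impI ballI)
  fix V :: "nat \<Rightarrow> 'a set" and x
  assume up: "\<forall>p. upset (W, R) (V p)" and x: "x \<in> fst (W, R)"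
  let ?F = "(f ` W, map_prod f f ` R)" and ?V = "\<lambda>p. f ` V p"
  have sub: "V p \<subseteq> W" for p using up by (simp add: upset_def)
  have rel: "(f y, f z) \<in> map_prod f f ` R \<longleftrightarrow> (y, z) \<in> R" if "y \<in> W" "z \<in> W" for y z
  proof
    assume "(f y, f z) \<in> map_prod f f ` R"
    then obtain a b where "(a, b) \<in> R" "f y = f a" "f z = f b" by auto
    with R that inj show "(y, z) \<in> R" by (metis SigmaD1 SigmaD2 inj_onD subsetD)
  qed force
  have up': "upset ?F (?V p)" for p
    unfolding upset_def prod.case
  proof (intro conjI allI impI)
    show "?V p \<subseteq> f ` W" using sub by auto
    fix y z assume "y \<in> ?V p" and yz: "(y, z) \<in> map_prod f f ` R"
    then obtain a where a: "a \<in> V p" "y = f a" by auto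
    from yz obtain b c where bc: "(b, c) \<in> R" "y = f b" "z = f c" by auto
    have "a = b" using a bc R sub inj by (metis SigmaD1 inj_onD subsetD)
    then have "c \<in> V p" using a bc up by (auto simp: upset_def)
    then show "z \<in> ?V p" using bc by simp
  qed
  have "forces ?F ?V (f y) B \<longleftrightarrow> forces (W, R) V y B" if "y \<in> W" for y B
    using that
  proof (induction B arbitrary: y)
    case (Var p)
    then show ?case using inj sub by (simp add: inj_on_image_mem_iff)
  next
    case (Imp B C)
    then show ?case by (auto simp: rel)
  qed auto
  moreover have "forces ?F ?V (f x) A" using v up' x by (simp add: valid_def)
  ultimately show "forces (W, R) V x A" using x by simp
qed

lemma valid_iso:
  fixes f :: "'a \<Rightarrow> 'b" and W :: "'a set" and R :: "'a rel"
  assumes inj: "inj_on f W" and R: "R \<subseteq> W \<times> W"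
  shows "valid (f ` W, map_prod f f ` R) A \<longleftrightarrow> valid (W, R) A"
proof
  assume v: "valid (W, R) A"
  let ?g = "the_inv_into W f"
  have W: "?g ` f ` W = W"
    using inj by (simp add: the_inv_into_onto)
  have "(\<lambda>p. map_prod ?g ?g (map_prod f f p)) ` R = (\<lambda>p. p) ` R"
  proof (rule image_cong[OF refl])
    fix p assume "p \<in> R"
    moreover obtain a b where "p = (a, b)" by (cases p)
    ultimately show "map_prod ?g ?g (map_prod f f p) = p"
      using R inj by (simp add: subset_iff the_inv_into_f_f)
  qed
  then have "map_prod ?g ?g ` map_prod f f ` R = R" by (simp add: image_image)
  with v W have "valid (?g ` f ` W, map_prod ?g ?g ` map_prod f f ` R) A" by simp
  moreover have "inj_on ?g (f ` W)" using inj by (rule inj_on_the_inv_into)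
  moreover have "map_prod f f ` R \<subseteq> f ` W \<times> f ` W" using R by auto
  ultimately show "valid (f ` W, map_prod f f ` R) A" by (rule valid_transfer[rotated 2])
qed (rule valid_transfer[OF inj R])

lemma Fin_eq_imp_validates_iff:
  fixes F :: "'a frame"
  assumes eq: "Fin L = Fin L'" and F: "is_poset F" "finite (fst F)"
  shows "validates F L \<longleftrightarrow> validates F L'"
proof -
  obtain W R where WR: "F = (W, R)" by (cases F)
  obtain f :: "'a \<Rightarrow> nat" where inj: "inj_on f W"
    using F WR finite_imp_inj_to_nat_seg by fastforce
  have po: "partial_order_on W R" using F WR by (simp add: is_poset_def)
  then have R: "R \<subseteq> W \<times> W" by (simp add: partial_order_on_def preorder_on_def)
  let ?G = "(f ` W, map_prod f f ` R)"
  have "refl_on (f ` W) (map_prod f f ` R)"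
    using po by (force simp: partial_order_on_def preorder_on_def refl_on_def)
  moreover have "trans (map_prod f f ` R)"
  proof (rule transI)
    fix x y z assume "(x, y) \<in> map_prod f f ` R" "(y, z) \<in> map_prod f f ` R"
    then obtain a b b' c where "(a, b) \<in> R" "(b', c) \<in> R" "x = f a" "y = f b" "y = f b'" "z = f c"
      by auto
    moreover from this have "b = b'" using R inj by (metis SigmaD1 SigmaD2 inj_onD subsetD)
    ultimately have "(a, c) \<in> R" "x = f a" "z = f c"
      using po by (auto simp: partial_order_on_def preorder_on_def elim: transE)
    then show "(x, z) \<in> map_prod f f ` R" by force
  qed
  moreover have "antisym (map_prod f f ` R)"
  proof (rule antisymI)
    fix x y assume "(x, y) \<in> map_prod f f ` R" "(y, x) \<in> map_prod f f ` R"
    then obtain a b b' a' where ab: "(a, b) \<in> R" "(b', a') \<in> R"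
      and xy: "x = f a" "y = f b" "y = f b'" "x = f a'" by auto
    have "b = b'" "a = a'" using ab xy R inj by (metis SigmaD1 SigmaD2 inj_onD subsetD)+
    then have "a = b" using ab po by (auto simp: partial_order_on_def dest: antisymD)
    then show "x = y" using xy by simp
  qed
  moreover have "map_prod f f ` R \<subseteq> f ` W \<times> f ` W" using R by auto
  ultimately have "is_poset ?G"
    by (simp add: is_poset_def partial_order_on_def preorder_on_def)
  moreover have "finite (fst ?G)" using F WR by simp
  ultimately have "?G \<in> Fin K \<longleftrightarrow> validates ?G K" for K
    unfolding Fin_def by blast
  with eq have "validates ?G L \<longleftrightarrow> validates ?G L'" by blast
  then show ?thesis unfolding WR validates_def valid_iso[OF inj R] .
qed

end

theory Submission
  imports Defs "HOL-Library.Countable"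
begin

text \<open>
  The upper bound holds because there are only countably many formulas. For the lower bound,
  write \<open>N = n - 2\<close>, which is positive, and let \<open>T\<^sub>k\<close> consist of a root below \<open>N\<close> extra points
  and an infinite descending Rieger--Nishimura ladder whose first rung is doubled; on top of all
  this sits a finite ladder of length \<open>k\<close>. The only antichains of size \<open>n + 1\<close> in \<open>T\<^sub>k\<close> contain
  the two maximal rungs of the infinite ladder, the double, and all extra points. A p-morphism
  that keeps the first three incomparable is injective on the infinite ladder, so every finite
  rooted p-morphic image of an upset of \<open>T\<^sub>k\<close> has width at most \<open>n\<close>. By Jankov's lemma the
  intersection of \<open>BW n\<close> with the logics of any family of the \<open>T\<^sub>k\<close> has the same finite frames
  as \<open>BW n\<close>. The upset of \<open>T\<^sub>k\<close> generated by the third rung is finite and rigid enough not to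
  be an image of an upset of \<open>T\<^sub>m\<close> for \<open>m \<noteq> k\<close>. As \<open>T\<^sub>k\<close> refutes \<open>bw n\<close> at its root, the disjunction of the
  Jankov formula of this upset with \<open>bw n\<close> lies in \<open>BW n\<close> and singles out \<open>T\<^sub>k\<close>, so different
  families yield different logics.
\<close>

section \<open>Soundness of Kripke semantics\<close>

lemma is_posetD:
  assumes "is_poset F"
  shows "x \<in> fst F \<Longrightarrow> (x, x) \<in> snd F"
    and "(x, y) \<in> snd F \<Longrightarrow> (y, z) \<in> snd F \<Longrightarrow> (x, z) \<in> snd F"
    and "(x, y) \<in> snd F \<Longrightarrow> (y, x) \<in> snd F \<Longrightarrow> x = y"
    and "(x, y) \<in> snd F \<Longrightarrow> x \<in> fst F"
    and "(x, y) \<in> snd F \<Longrightarrow> y \<in> fst F"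
  using assms
  by (auto simp: is_poset_def partial_order_on_def preorder_on_def split_beta
      dest: refl_onD transD antisymD)

lemma upset_iff:
  "upset F X \<longleftrightarrow> X \<subseteq> fst F \<and> (\<forall>x y. x \<in> X \<longrightarrow> (x, y) \<in> snd F \<longrightarrow> y \<in> X)"
  by (simp add: upset_def split_beta)

lemma forces_persistent:
  assumes "is_poset F" "\<forall>p. upset F (V p)"
    and "(x, y) \<in> snd F" "forces F V x A"
  shows "forces F V y A"
  using assms(3,4)
proof (induction A arbitrary: x y)
  case (Var p)
  then show ?case using assms(2) by (auto simp: upset_iff)
next
  case (Imp A B)
  then show ?case unfolding forces.simps using is_posetD(2)[OF assms(1)] by metis
qed auto

lemma IPC_sound:
  assumes F: "is_poset F" and "A \<in> IPC"
  shows "valid F A"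
  using assms(2)
proof (induction rule: IPC.induct)
  case (K A B)
  show ?case unfolding valid_def forces.simps using forces_persistent[OF F] by metis
next
  case (S A B C)
  show ?case unfolding valid_def forces.simps using is_posetD[OF F] by metis
next
  case (andI A B)
  show ?case unfolding valid_def forces.simps using forces_persistent[OF F] by metis
next
  case (orE A C B)
  show ?case unfolding valid_def forces.simps using is_posetD[OF F] by metis
next
  case (mp A B)
  then show ?case unfolding valid_def forces.simps using is_posetD[OF F] by metis
qed (simp_all add: valid_def)

lemma forces_fsubst:
  assumes "x \<in> fst F"
  shows "forces F V x (fsubst \<sigma> A) \<longleftrightarrow> forces F (\<lambda>p. {y \<in> fst F. forces F V y (\<sigma> p)}) x A"
  using assms by (induction A arbitrary: x) auto

lemma si_logic_valid:
  fixes F :: "'a frame"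
  assumes F: "is_poset F"
  shows "si_logic {A. valid F A}"
  unfolding si_logic_def
proof (intro conjI allI impI)
  show "IPC \<subseteq> {A. valid F A}" using IPC_sound[OF F] by blast
  show "B \<in> {A. valid F A}" if "Imp A B \<in> {A. valid F A}" "A \<in> {A. valid F A}" for A B
    using that is_posetD[OF F] by (auto simp: valid_def)
  fix \<sigma> A
  assume A: "A \<in> {A. valid F A}"
  have "valid F (fsubst \<sigma> A)"
    unfolding valid_def
  proof (intro allI impI ballI)
    fix V :: "nat \<Rightarrow> 'a set" and x
    assume V: "\<forall>p. upset F (V p)" and x: "x \<in> fst F"
    have "\<forall>p. upset F {y \<in> fst F. forces F V y (\<sigma> p)}"
      using forces_persistent[OF F V] is_posetD(5)[OF F] by (auto simp: upset_iff)
    then show "forces F V x (fsubst \<sigma> A)"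
      using A x by (simp add: valid_def forces_fsubst)
  qed
  then show "fsubst \<sigma> A \<in> {A. valid F A}" by simp
qed

section \<open>Bounded width: membership, validity and refutation\<close>

lemma si_logic_Inter:
  assumes "\<And>L. L \<in> \<L> \<Longrightarrow> si_logic L"
  shows "si_logic (\<Inter>\<L>)"
  using assms unfolding si_logic_def by blast

lemma si_logic_BW: "si_logic (BW n)"
  unfolding BW_def IPC_plus_def by (rule si_logic_Inter) blast

lemma bw_in_BW: "bw n \<in> BW n"
  by (auto simp: BW_def IPC_plus_def)

text \<open>Weakening an arbitrary formula by \<open>bw n\<close> puts it into \<open>BW n\<close>;
  this is how Jankov formulas enter sublogics of \<open>BW n\<close>.\<close>

lemma Or_bw_in_BW: "Or A (bw n) \<in> BW n"
  using si_logic_BW[of n] bw_in_BW[of n] IPC.orI2[of "bw n" A]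
  unfolding si_logic_def by blast

lemma validates_BW_iff:
  assumes F: "is_poset F"
  shows "validates F (BW n) \<longleftrightarrow> valid F (bw n)"
proof
  assume "valid F (bw n)"
  then have "BW n \<subseteq> {A. valid F A}"
    using si_logic_valid[OF F] by (auto simp: BW_def IPC_plus_def)
  then show "validates F (BW n)" by (auto simp: validates_def)
qed (simp add: validates_def bw_in_BW)

lemma forces_disj [simp]: "forces F V x (disj As) \<longleftrightarrow> (\<exists>A \<in> set As. forces F V x A)"
  by (induction As rule: disj.induct) auto

text \<open>If the \<open>V i\<close> are upsets, the witnesses above \<open>x\<close> form an
  antichain of size \<open>n + 1\<close>, which ties \<open>bw n\<close> to width.\<close>

lemma not_forces_bw_iff:
  assumes F: "is_poset F"
  shows "\<not> forces F V x (bw n) \<longleftrightarrow>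
    (\<forall>i \<le> n. \<exists>y. (x, y) \<in> snd F \<and> y \<in> V i \<and> (\<forall>j \<le> n. j \<noteq> i \<longrightarrow> y \<notin> V j))"
proof -
  have "forces F V x (bw n) \<longleftrightarrow>
    (\<exists>i \<le> n. \<forall>y \<in> fst F. (x, y) \<in> snd F \<longrightarrow> y \<in> V i \<longrightarrow> (\<exists>j \<le> n. j \<noteq> i \<and> y \<in> V j))"
    by (simp add: bw_def atLeast0LessThan lessThan_Suc_atMost Bex_def Ball_def conj_assoc
        del: upt_Suc)
  then show ?thesis using is_posetD(5)[OF F] by blast
qed


section \<open>The Jankov formula of a finite rooted poset\<close>

text \<open>Only values on the upset generated by \<open>h\<close> matter; the back condition makes
  \<open>f\<close> map it onto the upset generated by \<open>x\<close>.\<close>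

definition pmorphism :: "'a frame \<Rightarrow> 'a \<Rightarrow> 'b frame \<Rightarrow> 'b \<Rightarrow> ('a \<Rightarrow> 'b) \<Rightarrow> bool" where
  "pmorphism F h G x f \<longleftrightarrow> f h = x
     \<and> (\<forall>y z. (h, y) \<in> snd F \<longrightarrow> (y, z) \<in> snd F \<longrightarrow> (f y, f z) \<in> snd G)
     \<and> (\<forall>y b. (h, y) \<in> snd F \<longrightarrow> (f y, b) \<in> snd G \<longrightarrow> (\<exists>z. (y, z) \<in> snd F \<and> f z = b))"

primrec conj_list :: "fm list \<Rightarrow> fm" where
  "conj_list [] = Imp Bot Bot"
| "conj_list (A # As) = And A (conj_list As)"

lemma forces_conj_list [simp]: "forces F V x (conj_list As) \<longleftrightarrow> (\<forall>A \<in> set As. forces F V x A)"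
  by (induction As) auto

text \<open>
  The variable \<open>v a\<close> stands for the principal upset of \<open>a\<close>, and \<open>not_below R v xs b\<close> for the
  set of all points that are not below \<open>b\<close>.
\<close>

definition not_below :: "'a rel \<Rightarrow> ('a \<Rightarrow> nat) \<Rightarrow> 'a list \<Rightarrow> 'a \<Rightarrow> fm" where
  "not_below R v xs b = disj [Var (v c). c \<leftarrow> xs, (c, b) \<notin> R]"

text \<open>The first two families of premises make the variables true at a point correspond to a
  downward closed, directed set. The third encodes the back condition: a point outside
  \<open>not_below R v xs b\<close> sees a point of \<open>v b\<close> that is still outside
  it.\<close>

definition jankov :: "'a rel \<Rightarrow> ('a \<Rightarrow> nat) \<Rightarrow> 'a list \<Rightarrow> 'a \<Rightarrow> fm" where
  "jankov R v xs x = Imp (conj_list (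
      Var (v x)
    # [Imp (Var (v a)) (Var (v b)). a \<leftarrow> xs, b \<leftarrow> xs, (b, a) \<in> R]
    @ [Imp (And (Var (v a)) (Var (v b))) (disj [Var (v c). c \<leftarrow> xs, (a, c) \<in> R \<and> (b, c) \<in> R]).
        a \<leftarrow> xs, b \<leftarrow> xs]
    @ [Imp (Imp (Var (v b)) (not_below R v xs b)) (not_below R v xs b). b \<leftarrow> xs]))
    (not_below R v xs x)"

lemma forces_not_below [simp]:
  "forces F V y (not_below R v xs b) \<longleftrightarrow> (\<exists>c \<in> set xs. (c, b) \<notin> R \<and> y \<in> V (v c))"
  by (auto simp: not_below_def)

text \<open>The intended valuation satisfies the premises at \<open>x\<close>, while the conclusion
  fails there because \<open>x\<close> is below itself. Only the variables \<open>v a\<close> are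
  prescribed, so others stay free for refuting \<open>bw n\<close>.\<close>

lemma jankov_refuted:
  assumes F: "is_poset F" and x: "x \<in> fst F" and xs: "set xs = {y. (x, y) \<in> snd F}"
    and V: "\<And>a. (x, a) \<in> snd F \<Longrightarrow> V (v a) = {y. (a, y) \<in> snd F}"
  shows "\<not> forces F V x (jankov (snd F) v xs x)"
proof -
  note P = is_posetD[OF F]
  let ?q = "not_below (snd F) v xs"
  have xx: "(x, x) \<in> snd F" using P x by blast
  have q_iff: "forces F V y (?q b) \<longleftrightarrow> (y, b) \<notin> snd F"
    if "(x, y) \<in> snd F" "(x, b) \<in> snd F" for y b
  proof -
    have "forces F V y (?q b) \<longleftrightarrow> (\<exists>c. (x, c) \<in> snd F \<and> (c, b) \<notin> snd F \<and> (c, y) \<in> snd F)"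
      unfolding forces_not_below xs using V by (metis mem_Collect_eq)
    then show ?thesis using that P(1,2,5) by metis
  qed
  have "forces F V x (Imp (Imp (Var (v b)) (?q b)) (?q b))" if b: "(x, b) \<in> snd F" for b
    unfolding forces.simps(5)
  proof (intro ballI impI)
    fix y
    assume y: "(x, y) \<in> snd F"
      and imp: "\<forall>z \<in> fst F. (y, z) \<in> snd F \<longrightarrow> forces F V z (Var (v b)) \<longrightarrow> forces F V z (?q b)"
    have "\<not> (y, b) \<in> snd F"
    proof
      assume "(y, b) \<in> snd F"
      moreover have "b \<in> fst F" "(b, b) \<in> snd F" using P b by blast+
      ultimately have "forces F V b (?q b)" using imp V b by simp
      then show False using q_iff b \<open>(b, b) \<in> snd F\<close> by blast
    qed
    then show "forces F V y (?q b)" using q_iff y b by blast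
  qed
  moreover have "forces F V x (Imp (Var (v a)) (Var (v b)))"
    if "(x, a) \<in> snd F" "(x, b) \<in> snd F" "(b, a) \<in> snd F" for a b
    unfolding forces.simps V[OF that(1)] V[OF that(2)] using that(3) P(2) by blast
  moreover have "forces F V x (Imp (And (Var (v a)) (Var (v b)))
      (disj [Var (v c). c \<leftarrow> xs, (a, c) \<in> snd F \<and> (b, c) \<in> snd F]))"
    if "(x, a) \<in> snd F" "(x, b) \<in> snd F" for a b
    unfolding forces.simps
  proof (intro ballI impI)
    fix y
    assume y: "y \<in> fst F" "(x, y) \<in> snd F" "y \<in> V (v a) \<and> y \<in> V (v b)"
    then have "(a, y) \<in> snd F" "(b, y) \<in> snd F" "y \<in> V (v y)" "y \<in> set xs"
      unfolding xs V[OF that(1)] V[OF that(2)] V[OF y(2)] using P(1) by blast+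
    then show "forces F V y (disj [Var (v c). c \<leftarrow> xs, (a, c) \<in> snd F \<and> (b, c) \<in> snd F])"
      by auto
  qed
  moreover have "x \<in> V (v x)" unfolding V[OF xx] using xx by simp
  ultimately have "forces F V x A"
    if "A \<in> set (Var (v x)
    # [Imp (Var (v a)) (Var (v b)). a \<leftarrow> xs, b \<leftarrow> xs, (b, a) \<in> snd F]
    @ [Imp (And (Var (v a)) (Var (v b))) (disj [Var (v c). c \<leftarrow> xs, (a, c) \<in> snd F \<and> (b, c) \<in> snd F]).
        a \<leftarrow> xs, b \<leftarrow> xs]
    @ [Imp (Imp (Var (v b)) (?q b)) (?q b). b \<leftarrow> xs])" for A
    using that xs by (auto simp del: forces.simps(5) forces_not_below forces_disj)
  moreover have "\<not> forces F V x (?q x)" using q_iff xx by blast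
  ultimately show ?thesis
    unfolding jankov_def forces.simps(5) forces_conj_list using x xx by blast
qed

lemma finite_directed_has_greatest:
  assumes "finite S" "S \<noteq> {}" and refl: "\<And>a. a \<in> S \<Longrightarrow> (a, a) \<in> R" and "trans R"
    and dir: "\<And>a b. a \<in> S \<Longrightarrow> b \<in> S \<Longrightarrow> \<exists>c \<in> S. (a, c) \<in> R \<and> (b, c) \<in> R"
  shows "\<exists>c \<in> S. \<forall>a \<in> S. (a, c) \<in> R"
proof -
  have "\<exists>c \<in> S. \<forall>a \<in> B. (a, c) \<in> R" if "finite B" "B \<subseteq> S" for B
    using that
  proof (induction B rule: finite_induct)
    case empty
    then show ?case using assms(2) by auto
  next
    case (insert b B)
    then obtain c where "c \<in> S" "\<forall>a \<in> B. (a, c) \<in> R" by auto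
    with dir[of b c] insert.prems show ?case by (metis assms(4) insert_iff insert_subset transE)
  qed
  then show ?thesis using assms(1) by blast
qed

lemma jankov_imp_pmorphism:
  assumes F: "is_poset F" and G: "is_poset G" and x: "x \<in> fst G"
    and xs: "set xs = {y. (x, y) \<in> snd G}"
    and nv: "\<not> valid F (jankov (snd G) v xs x)"
  shows "\<exists>h f. h \<in> fst F \<and> pmorphism F h G x f"
proof -
  note P = is_posetD[OF F] and Q = is_posetD[OF G]
  let ?q = "not_below (snd G) v xs"
  obtain V h where V: "\<forall>p. upset F (V p)" and h: "h \<in> fst F"
    and root: "h \<in> V (v x)"
    and down: "\<And>a b. (x, a) \<in> snd G \<Longrightarrow> (x, b) \<in> snd G \<Longrightarrow> (b, a) \<in> snd G
      \<Longrightarrow> forces F V h (Imp (Var (v a)) (Var (v b)))"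
    and dir: "\<And>a b. (x, a) \<in> snd G \<Longrightarrow> (x, b) \<in> snd G \<Longrightarrow>
      forces F V h (Imp (And (Var (v a)) (Var (v b)))
        (disj [Var (v c). c \<leftarrow> xs, (a, c) \<in> snd G \<and> (b, c) \<in> snd G]))"
    and cover: "\<And>b. (x, b) \<in> snd G \<Longrightarrow> forces F V h (Imp (Imp (Var (v b)) (?q b)) (?q b))"
    and nq: "\<not> forces F V h (?q x)"
  proof -
    from nv obtain V h0 where V: "\<forall>p. upset F (V p)" "h0 \<in> fst F"
      and "\<not> forces F V h0 (jankov (snd G) v xs x)" unfolding valid_def by blast
    then obtain h where "h \<in> fst F" "(h0, h) \<in> snd F" "\<not> forces F V h (?q x)"
      and "\<forall>A \<in> set (Var (v x)
    # [Imp (Var (v a)) (Var (v b)). a \<leftarrow> xs, b \<leftarrow> xs, (b, a) \<in> snd G]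
    @ [Imp (And (Var (v a)) (Var (v b))) (disj [Var (v c). c \<leftarrow> xs, (a, c) \<in> snd G \<and> (b, c) \<in> snd G]).
        a \<leftarrow> xs, b \<leftarrow> xs]
    @ [Imp (Imp (Var (v b)) (?q b)) (?q b). b \<leftarrow> xs]). forces F V h A"
      unfolding jankov_def forces.simps(5) forces_conj_list by blast
    then show ?thesis using V xs that[of V h]
      by (simp del: forces.simps(5) forces_not_below forces_disj add: ball_Un)
  qed
  \<comment> \<open>The points whose variables hold at \<open>y\<close> form a finite directed
    downset, hence have a greatest element. This element will be \<open>f y\<close>.\<close>
  have "\<exists>a. (x, a) \<in> snd G \<and> (\<forall>b. (x, b) \<in> snd G \<longrightarrow> y \<in> V (v b) \<longleftrightarrow> (b, a) \<in> snd G)"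
    if y: "(h, y) \<in> snd F" for y
  proof -
    let ?S = "{b \<in> set xs. y \<in> V (v b)}"
    have yF: "y \<in> fst F" using P y by blast
    have "\<exists>c \<in> ?S. \<forall>a \<in> ?S. (a, c) \<in> snd G"
    proof (rule finite_directed_has_greatest)
      have "y \<in> V (v x)" using root V y unfolding upset_iff by metis
      moreover have "x \<in> set xs" using xs Q(1)[OF x] by blast
      ultimately show "?S \<noteq> {}" by blast
      show "(a, a) \<in> snd G" if "a \<in> ?S" for a using that Q(1)[OF Q(5)] unfolding xs by blast
      show "trans (snd G)" using Q(2) by (rule transI)
      show "\<exists>c \<in> ?S. (a, c) \<in> snd G \<and> (b, c) \<in> snd G" if "a \<in> ?S" "b \<in> ?S" for a b
      proof -
        have "forces F V y (disj [Var (v c). c \<leftarrow> xs, (a, c) \<in> snd G \<and> (b, c) \<in> snd G])"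
          using that dir[of a b] xs y yF unfolding forces.simps by blast
        then show ?thesis by auto
      qed
    qed simp
    then obtain c where c: "c \<in> ?S" "\<forall>a \<in> ?S. (a, c) \<in> snd G" by blast
    have "y \<in> V (v b)" if "(x, b) \<in> snd G" "(b, c) \<in> snd G" for b
      using down[of c b] that c(1) xs y yF unfolding forces.simps by blast
    with c xs show ?thesis by blast
  qed
  then obtain f where f: "\<And>y. (h, y) \<in> snd F \<Longrightarrow> (x, f y) \<in> snd G"
    and f_iff: "\<And>y b. (h, y) \<in> snd F \<Longrightarrow> (x, b) \<in> snd G \<Longrightarrow> y \<in> V (v b) \<longleftrightarrow> (b, f y) \<in> snd G"
    by metis
  have q_iff: "forces F V y (?q b) \<longleftrightarrow> (f y, b) \<notin> snd G"
    if "(h, y) \<in> snd F" "(x, b) \<in> snd G" for y b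
  proof -
    have "forces F V y (?q b) \<longleftrightarrow> (\<exists>c. (x, c) \<in> snd G \<and> (c, b) \<notin> snd G \<and> (c, f y) \<in> snd G)"
      unfolding forces_not_below xs using f_iff that(1) by (metis mem_Collect_eq)
    then show ?thesis using that(2) f[OF that(1)] Q(1,2,5) by metis
  qed
  have "pmorphism F h G x f"
    unfolding pmorphism_def
  proof (intro conjI allI impI)
    have hh: "(h, h) \<in> snd F" using P h by blast
    have "(f h, x) \<in> snd G" using q_iff[OF hh] nq Q x by blast
    then show "f h = x" using f[OF hh] Q by blast
  next
    fix y z
    assume yz: "(h, y) \<in> snd F" "(y, z) \<in> snd F"
    have "y \<in> V (v (f y))" using f_iff f yz Q by blast
    then have "z \<in> V (v (f y))" using V yz by (auto simp: upset_iff)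
    then show "(f y, f z) \<in> snd G" using f_iff f yz P by blast
  next
    fix y b
    assume y: "(h, y) \<in> snd F" and b: "(f y, b) \<in> snd G"
    have xb: "(x, b) \<in> snd G" using f y b Q by blast
    \<comment> \<open>As \<open>f y\<close> is below \<open>b\<close>, the premise
      \<open>cover\<close> yields \<open>z\<close> above \<open>y\<close> in \<open>V (v b)\<close>
      but outside \<open>?q b\<close>; these two facts pin \<open>f z\<close> to
      \<open>b\<close>.\<close>
    have "\<not> forces F V y (?q b)" using q_iff y xb b by blast
    then have "\<not> forces F V y (Imp (Var (v b)) (?q b))"
      using cover[OF xb] y P(5) unfolding forces.simps(5) by metis
    then obtain z where z: "(y, z) \<in> snd F" "z \<in> V (v b)" "\<not> forces F V z (?q b)"
      unfolding forces.simps by blast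
    then have hz: "(h, z) \<in> snd F" using y P by blast
    have "(b, f z) \<in> snd G" using f_iff hz xb z by blast
    moreover have "(f z, b) \<in> snd G" using q_iff hz xb z by blast
    ultimately show "\<exists>z. (y, z) \<in> snd F \<and> f z = b" using z Q by blast
  qed
  then show ?thesis using h by blast
qed

section \<open>The towers\<close>

text \<open>
  Rungs are numbered from the top, so \<open>ladder a b\<close> puts the \<open>a\<close>-th rung below the \<open>b\<close>-th. In
  the order on \<open>pt\<close>, \<open>Side\<close> is the double of \<open>Rung 0\<close>: without it, \<open>Rung 2\<close> could be collapsed
  into \<open>Rung 0\<close>.
\<close>

definition ladder :: "nat \<Rightarrow> nat \<Rightarrow> bool" where
  "ladder a b \<longleftrightarrow> a = b \<or> b + 2 \<le> a"

datatype pt = Top nat | Rung nat | Side | Extra nat | Root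

instance pt :: countable by countable_datatype

fun below :: "pt \<Rightarrow> pt \<Rightarrow> bool" where
  "below (Top a) (Top b) \<longleftrightarrow> ladder a b"
| "below (Top a) _ \<longleftrightarrow> False"
| "below _ (Top b) \<longleftrightarrow> True"
| "below (Rung a) (Rung b) \<longleftrightarrow> ladder a b"
| "below (Rung a) Side \<longleftrightarrow> 2 \<le> a"
| "below Side Side \<longleftrightarrow> True"
| "below (Extra a) (Extra b) \<longleftrightarrow> a = b"
| "below Root _ \<longleftrightarrow> True"
| "below _ _ \<longleftrightarrow> False"

definition points :: "nat \<Rightarrow> nat \<Rightarrow> pt set" where
  "points k N = Top ` {..k} \<union> range Rung \<union> {Side, Root} \<union> Extra ` {..<N}"

definition tower :: "nat \<Rightarrow> nat \<Rightarrow> pt frame" where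
  "tower k N = (points k N, {(a, b). a \<in> points k N \<and> b \<in> points k N \<and> below a b})"

lemma points_iff [simp]:
  "Top j \<in> points k N \<longleftrightarrow> j \<le> k" "Rung j \<in> points k N" "Side \<in> points k N"
  "Root \<in> points k N" "Extra j \<in> points k N \<longleftrightarrow> j < N"
  by (auto simp: points_def)

lemma fst_tower [simp]: "fst (tower k N) = points k N"
  by (simp add: tower_def)

lemma in_snd_tower [simp]:
  "(a, b) \<in> snd (tower k N) \<longleftrightarrow> a \<in> points k N \<and> b \<in> points k N \<and> below a b"
  by (simp add: tower_def)

lemma below_refl: "below a a"
  by (cases a) (auto simp: ladder_def)

lemma below_Root [simp]: "below Root a"
  by (cases a) auto

lemma below_antisym: "below a b \<Longrightarrow> below b a \<Longrightarrow> a = b"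
  by (cases a; cases b) (auto simp: ladder_def)

lemma below_trans: "below a b \<Longrightarrow> below b c \<Longrightarrow> below a c"
  by (cases a; cases b; cases c) (auto simp: ladder_def)

lemma is_poset_tower: "is_poset (tower k N)"
  unfolding is_poset_def tower_def prod.case partial_order_on_def preorder_on_def
  using below_refl below_antisym below_trans
  by (auto intro!: refl_onI transI antisymI)

section \<open>Wide antichains and finite images of towers\<close>

text \<open>Without \<open>Side\<close> the tower splits into \<open>N + 2\<close> chains, so
  \<open>Side\<close> lies in \<open>A\<close>. Only \<open>Rung 0\<close>, \<open>Rung 1\<close>
  and the \<open>N\<close> extra points are incomparable to it, so \<open>A\<close> must contain all
  of them.\<close>

lemma antichain_in_tower:
  assumes A: "A \<subseteq> points k N" "card A = N + 3"
    and anti: "\<And>a b. a \<in> A \<Longrightarrow> b \<in> A \<Longrightarrow> below a b \<Longrightarrow> a = b"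
  shows "Rung 0 \<in> A" "Rung 1 \<in> A" "Side \<in> A" "0 < N \<Longrightarrow> \<exists>j. Extra j \<in> A"
proof -
  have Side: "Side \<in> A"
  proof (rule ccontr)
    assume Side: "Side \<notin> A"
    \<comment> \<open>The colours name the chains: parity for tops and rungs, with
      \<open>Root\<close> added to the even ones, and one colour per extra point.\<close>
    define c where
      "c a = (case a of Top j \<Rightarrow> j mod 2 | Rung j \<Rightarrow> j mod 2 | Extra j \<Rightarrow> j + 2 | _ \<Rightarrow> 0)" for a
    have lad: "ladder a b \<or> ladder b a" if "a mod 2 = b mod 2" for a b
      using that unfolding ladder_def by presburger
    have "a = b" if "a \<in> A" "b \<in> A" "c a = c b" for a b
    proof -
      have "a \<noteq> Side" "b \<noteq> Side" using that Side by auto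
      then have "below a b \<or> below b a"
        using that(3) lad by (cases a; cases b) (auto simp: c_def)
      then show ?thesis using anti that by blast
    qed
    then have "inj_on c A" by (auto intro: inj_onI)
    moreover have "c ` A \<subseteq> {..<N + 2}"
    proof
      fix i
      assume "i \<in> c ` A"
      then obtain a where "a \<in> points k N" "i = c a" using A by blast
      then show "i \<in> {..<N + 2}" by (cases a) (auto simp: c_def less_Suc_eq)
    qed
    ultimately have "card A \<le> card {..<N + 2}"
      by (intro card_inj_on_le) auto
    then show False using A by simp
  qed
  then show "Side \<in> A" .
  have "a \<in> {Rung 0, Rung 1, Side} \<union> Extra ` {..<N}" if "a \<in> A" for a
  proof -
    have "a \<in> points k N" "\<not> below a Side \<and> \<not> below Side a \<or> a = Side"
      using that Side anti A by blast+
    then show ?thesis by (cases a) auto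
  qed
  then have sub: "A \<subseteq> {Rung 0, Rung 1, Side} \<union> Extra ` {..<N}" by blast
  have miss: "card A \<le> card B + card (Extra ` {..<N})"
    if "A \<subseteq> B \<union> Extra ` {..<N}" "finite B" for B
    using that by (meson card_Un_le card_mono finite_UnI finite_imageI finite_lessThan le_trans)
  have cardE: "card (Extra ` {..<N}) = N" by (simp add: card_image inj_on_def)
  show "Rung 0 \<in> A"
    using miss[of "{Rung 1, Side}"] sub A cardE by (cases "Rung 0 \<in> A") auto
  show "Rung 1 \<in> A"
    using miss[of "{Rung 0, Side}"] sub A cardE by (cases "Rung 1 \<in> A") auto
  show "\<exists>j. Extra j \<in> A" if "0 < N"
  proof (rule ccontr)
    assume "\<nexists>j. Extra j \<in> A"
    then have "A \<subseteq> {Rung 0, Rung 1, Side}" using sub by blast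
    then have "card A \<le> card {Rung 0, Rung 1, Side}" by (intro card_mono) auto
    then show False using A that by simp
  qed
qed

text \<open>
  If rungs \<open>i < j\<close> have the same image, then the image of rung \<open>i - 1\<close>, which rung \<open>j\<close> sees but
  rung \<open>i\<close> does not, is also the image of another point.
\<close>

lemma pmorphism_inj_on_rungs:
  assumes G: "is_poset G" and f: "pmorphism (tower k N) Root G x f"
    and R0: "(f Side, f (Rung 0)) \<notin> snd G" "(f (Rung 0), f Side) \<notin> snd G"
    and R1: "(f Side, f (Rung 1)) \<notin> snd G" "(f (Rung 1), f Side) \<notin> snd G"
    and R01: "(f (Rung 0), f (Rung 1)) \<notin> snd G" "(f (Rung 1), f (Rung 0)) \<notin> snd G"
  shows "inj (\<lambda>i. f (Rung i))"
proof (rule ccontr)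
  note Q = is_posetD[OF G]
  have mono: "(f a, f b) \<in> snd G" if "a \<in> points k N" "b \<in> points k N" "below a b" for a b
    using f that by (simp add: pmorphism_def)
  have lift: "\<exists>c. c \<in> points k N \<and> below a c \<and> f c = b"
    if "a \<in> points k N" "(f a, b) \<in> snd G" for a b
    using f that unfolding pmorphism_def in_snd_tower by (metis below_Root points_iff(4))
  assume "\<not> inj (\<lambda>i. f (Rung i))"
  then have ex: "\<exists>i j. i < j \<and> f (Rung i) = f (Rung j)"
    unfolding inj_def by (metis nat_neq_iff)
  define i where "i = (LEAST i. \<exists>j. i < j \<and> f (Rung i) = f (Rung j))"
  obtain j where j: "i < j" "f (Rung i) = f (Rung j)"
    using LeastI_ex[OF ex] unfolding i_def by blast
  have least: "f (Rung a) \<noteq> f (Rung b)" if "a < i" "a < b" for a b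
    using not_less_Least[of a] that unfolding i_def by blast
  have jS: "(f (Rung j), f Side) \<in> snd G" if "2 \<le> j" using mono that by simp
  \<comment> \<open>For \<open>j \<ge> 2\<close> the image of rung \<open>j\<close> is below
    \<open>f Side\<close>, unlike those of the first two rungs.\<close>
  have not0: "i \<noteq> 0"
  proof
    assume "i = 0"
    then show False using j jS R0 R01 Q mono[of "Rung 0" "Rung 0"]
      by (cases "j = 1") (auto simp: ladder_def)
  qed
  moreover have not1: "i \<noteq> 1"
    using j jS R1 by auto
  ultimately have i2: "2 \<le> i" by simp
  \<comment> \<open>Rung \<open>j\<close> is at least two rungs below rung \<open>i - 1\<close>, and
    rung \<open>i\<close> shares its image.\<close>
  have "(f (Rung i), f (Rung (i - 1))) \<in> snd G"
    unfolding j(2) using j(1) i2 by (intro mono) (auto simp: ladder_def)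
  then obtain c where c: "c \<in> points k N" "below (Rung i) c" "f c = f (Rung (i - 1))"
    using lift[of "Rung i"] by auto
  have noSide: "(f Side, f (Rung (i - 1))) \<notin> snd G"
  proof
    assume *: "(f Side, f (Rung (i - 1))) \<in> snd G"
    show False
    proof (cases "i = 2")
      case True
      then show False using * R1 by simp
    next
      case False
      then have "(f (Rung (i - 1)), f (Rung 0)) \<in> snd G"
        using i2 by (intro mono) (auto simp: ladder_def)
      then show False using * R0 Q by blast
    qed
  qed
  \<comment> \<open>A top or \<open>Side\<close> is excluded by \<open>noSide\<close>, and a rung by
    the minimality of \<open>i\<close>.\<close>
  show False
  proof (cases c)
    case (Top l)
    then show False using noSide c mono[of Side "Top l"] by simp
  next
    case (Rung l)
    show False
    proof (cases "l = i")
      case True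
      then show False using least[of "i - 1" i] c Rung i2 by simp
    next
      case False
      then have "l < i - 1" using c Rung by (auto simp: ladder_def)
      then show False using least[of l "i - 1"] c Rung by simp
    qed
  next
    case Side
    then show False using noSide c mono[of Side Side] by simp
  qed (use c in auto)
qed

text \<open>Preimages of the \<open>y i\<close> form an antichain of size \<open>N + 3\<close>, so
  \<open>Side\<close> and an extra point lie above \<open>h\<close>, which forces
  \<open>h = Root\<close>. The images of \<open>Rung 0\<close>, \<open>Rung 1\<close> and
  \<open>Side\<close> are incomparable, so the infinite ladder would embed into a finite
  poset.\<close>

lemma no_wide_finite_image:
  assumes G: "is_poset G" "finite (fst G)" and N: "0 < N"
    and h: "h \<in> points k N" and f: "pmorphism (tower k N) h G x f"
    and y: "\<And>i. i \<le> N + 2 \<Longrightarrow> (x, y i) \<in> snd G"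
    and anti: "\<And>i j. i \<le> N + 2 \<Longrightarrow> j \<le> N + 2 \<Longrightarrow> (y i, y j) \<in> snd G \<Longrightarrow> i = j"
  shows False
proof -
  note Q = is_posetD[OF G(1)]
  have mono: "(f a, f b) \<in> snd G"
    if "a \<in> points k N" "b \<in> points k N" "below h a" "below a b" for a b
    using f that h by (simp add: pmorphism_def)
  have "\<exists>a. a \<in> points k N \<and> below h a \<and> f a = y i" if "i \<le> N + 2" for i
  proof -
    have "(h, h) \<in> snd (tower k N)" "(f h, y i) \<in> snd G"
      using f h y[OF that] by (simp_all add: below_refl pmorphism_def)
    then obtain a where "(h, a) \<in> snd (tower k N)" "f a = y i"
      using f unfolding pmorphism_def by blast
    then show ?thesis by auto
  qed
  then obtain s where s: "\<And>i. i \<le> N + 2 \<Longrightarrow> s i \<in> points k N \<and> below h (s i) \<and> f (s i) = y i"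
    by metis
  let ?A = "s ` {..N + 2}"
  have s_anti: "i = j" if "i \<le> N + 2" "j \<le> N + 2" "below (s i) (s j)" for i j
    using mono[of "s i" "s j"] s[OF that(1)] s[OF that(2)] anti[OF that(1,2)] that(3) by auto
  have "inj_on s {..N + 2}"
  proof (rule inj_onI)
    fix i j
    assume "i \<in> {..N + 2}" "j \<in> {..N + 2}" "s i = s j"
    then show "i = j" using s_anti[of i j] below_refl[of "s j"] by simp
  qed
  then have card: "card ?A = N + 3" by (simp add: card_image)
  have sub: "?A \<subseteq> points k N" using s by auto
  have anti': "a = b" if "a \<in> ?A" "b \<in> ?A" "below a b" for a b
    using that s_anti by auto
  note A = antichain_in_tower(1-3)[OF sub card anti'] antichain_in_tower(4)[OF sub card anti' N]
  have "below h a" if "a \<in> ?A" for a using that s by blast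
  then have "below h Side" "\<exists>j. below h (Extra j)" using A by blast+
  then obtain j where "below h Side" "below h (Extra j)" by blast
  then have hR: "h = Root" by (cases h) auto
  have inc: "(f a, f b) \<notin> snd G" if ab: "a \<in> ?A" "b \<in> ?A" "a \<noteq> b" for a b
  proof -
    obtain i j where ij: "i \<le> N + 2" "j \<le> N + 2" "a = s i" "b = s j" using ab by auto
    then show ?thesis using s[OF ij(1)] s[OF ij(2)] anti[OF ij(1,2)] ab(3) by auto
  qed
  have "pmorphism (tower k N) Root G x f" using f hR by simp
  then have "inj (\<lambda>i. f (Rung i))"
    using inc[OF A(3,1)] inc[OF A(1,3)] inc[OF A(3,2)] inc[OF A(2,3)] inc[OF A(1,2)] inc[OF A(2,1)]
    by (intro pmorphism_inj_on_rungs[OF G(1)]) simp_all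
  moreover have "(f (Rung i), f (Rung i)) \<in> snd G" for i
    by (rule mono) (simp_all add: hR below_refl)
  then have "range (\<lambda>i. f (Rung i)) \<subseteq> fst G" using Q(4) by blast
  ultimately show False using G(2) by (metis finite_imageD finite_subset infinite_UNIV_nat)
qed

section \<open>Rigidity of the finite ladder\<close>

text \<open>
  The tops form a rigid ladder, whose length is marked by the two points \<open>Rung 0\<close> and \<open>Side\<close>
  directly below it.
\<close>

lemma pmorphism_onto_tower_part:
  assumes k: "2 \<le> k" and m: "2 \<le> m" and h: "h \<in> points m M"
    and f: "pmorphism (tower m M) h (tower k N) (Rung 2) f"
  shows "m = k"
proof -
  let ?P = "\<lambda>p. p \<in> points m M \<and> below h p"
  have fh: "f h = Rung 2" using f by (simp add: pmorphism_def)
  have mono: "f a \<in> points k N \<and> f b \<in> points k N \<and> below (f a) (f b)"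
    if "?P a" "b \<in> points m M" "below a b" for a b
    using f that h by (simp add: pmorphism_def)
  have lift: "\<exists>c. ?P c \<and> below a c \<and> f c = b" if "?P a" "b \<in> points k N" "below (f a) b" for a b
  proof -
    have "(h, a) \<in> snd (tower m M)" "(f a, b) \<in> snd (tower k N)"
      using that h mono[of a a] below_refl by simp_all
    then obtain c where "(a, c) \<in> snd (tower m M)" "f c = b"
      using f unfolding pmorphism_def by blast
    then show ?thesis using that(1) below_trans[of h a c] by auto
  qed
  have hP: "?P h" using h below_refl by blast
  have onto: "\<exists>p. ?P p \<and> f p = b" if "b \<in> points k N" "below (Rung 2) b" for b
    using lift[OF hP, of b] that fh by auto
  have range: "f p \<in> points k N" "below (Rung 2) (f p)" if "?P p" for p
    using mono[of h p] fh that hP by auto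
  \<comment> \<open>Images of maximal points are maximal, and \<open>Top 0\<close> and
    \<open>Top 1\<close> are the maximal points of the target.\<close>
  have top_max: "f (Top a) \<in> {Top 0, Top 1}" if "?P (Top a)" "a < 2" for a
  proof -
    have "c = Top a" if "below (Top a) c" for c
      using that \<open>a < 2\<close> by (cases c) (auto simp: ladder_def)
    then have max: "b = f (Top a)" if "b \<in> points k N" "below (f (Top a)) b" for b
      using lift[of "Top a" b] that \<open>?P (Top a)\<close> by blast
    show ?thesis
    proof (cases "f (Top a)")
      case (Top l)
      then show ?thesis using max[of "Top 0"] k by (cases "2 \<le> l") (auto simp: ladder_def)
    qed (use max[of "Top 0"] range[of "Top a"] that k in auto)
  qed
  have sees_top: "below p (Top 0) \<or> below p (Top 1)" for p
    by (cases p) (auto simp: ladder_def)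
  have P_up: "?P q" if "?P p" "q \<in> points m M" "below p q" for p q
    using that below_trans by blast
  \<comment> \<open>Maximal tops above \<open>p\<close> go to \<open>Top 0\<close>. Some maximal top
    does not, as \<open>Top 1\<close> has a preimage, and \<open>p\<close> cannot see it; this
    leaves only \<open>Top 2\<close>.\<close>
  have two: "p = Top 2" if p: "?P p" "f p = Top 2" for p
  proof -
    have fa: "f (Top a) = Top 0" if "a < 2" "below p (Top a)" for a
    proof -
      have "?P (Top a)" using P_up[OF p(1)] that m by auto
      then show ?thesis using top_max[of a] mono[OF p(1), of "Top a"] that p(2)
        by (auto simp: ladder_def)
    qed
    obtain p1 where p1: "?P p1" "f p1 = Top 1" using onto[of "Top 1"] k by auto
    obtain a where a: "a < 2" "below p1 (Top a)" using sees_top[of p1] that[of 0] that[of 1] by auto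
    have "f (Top a) \<noteq> Top 0"
      using mono[OF p1(1), of "Top a"] a p1(2) m by (auto simp: ladder_def)
    then have "\<not> below p (Top a)" using fa a by blast
    then obtain l where l: "p = Top l" "\<not> ladder l a" by (cases p) auto
    have "\<not> l < 2" using top_max[of l] p l(1) by auto
    then show ?thesis using l a by (auto simp: ladder_def)
  qed
  moreover obtain p2 where "?P p2" "f p2 = Top 2" using onto[of "Top 2"] k by auto
  ultimately have P2: "?P (Top 2)" "f (Top 2) = Top 2" by blast+
  have P0: "?P (Top 0)" using P_up[OF P2(1), of "Top 0"] by (simp add: ladder_def)
  have f0: "f (Top 0) = Top 0"
    using top_max[of 0] mono[OF P2(1), of "Top 0"] P2(2) P0 by (auto simp: ladder_def)
  have one: "p = Top 1" if p: "?P p" "f p = Top 1" for p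
  proof -
    have "\<not> below p (Top 0)" using mono[OF p(1), of "Top 0"] p(2) f0 by (auto simp: ladder_def)
    then show ?thesis by (cases p) (auto simp: ladder_def)
  qed
  moreover obtain p1 where "?P p1" "f p1 = Top 1" using onto[of "Top 1"] k by auto
  ultimately have P1: "?P (Top 1)" "f (Top 1) = Top 1" by blast+
  have zero: "p = Top 0" if p: "?P p" "f p = Top 0" for p
  proof -
    have "\<not> below p (Top 1)"
      using mono[OF p(1), of "Top 1"] p(2) P1(2) m by (auto simp: ladder_def)
    then obtain l where l: "p = Top l" "\<not> ladder l 1" by (cases p) auto
    then have "l = 0 \<or> l = 2" unfolding ladder_def by presburger
    then show ?thesis using P2(2) p(2) l(1) by auto
  qed
  have fixed: "(\<forall>p. ?P p \<longrightarrow> f p = Top j \<longrightarrow> p = Top j) \<and> ?P (Top j) \<and> f (Top j) = Top j"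
    if "j \<le> k" for j
    using that
  proof (induction j rule: less_induct)
    case (less j)
    have "p = Top j" if p: "?P p" "f p = Top j" for p
    proof (cases "j < 3")
      case True
      then have "j = 0 \<or> j = 1 \<or> j = 2" by auto
      then show ?thesis using zero one two p by blast
    next
      case False
      have IH: "?P (Top l)" "f (Top l) = Top l" if "l < j" for l
        using less that by auto
      \<comment> \<open>Only tops up to \<open>Top j\<close>, except \<open>Top (j - 1)\<close>,
        fail to see \<open>Top (j - 1)\<close>; all smaller tops are already fixed.\<close>
      have "\<not> below p (Top (j - 1))"
        using mono[OF p(1), of "Top (j - 1)"] IH[of "j - 1"] p(2) False
        by (auto simp: ladder_def)
      then obtain l where l: "p = Top l" "\<not> ladder l (j - 1)" by (cases p) auto
      then have "l < j \<or> l = j" using False unfolding ladder_def by linarith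
      then show ?thesis using IH[of l] p(2) l(1) by auto
    qed
    moreover have "\<exists>p. ?P p \<and> f p = Top j" using onto[of "Top j"] less.prems by simp
    ultimately show ?case by blast
  qed
  have "k \<le> m" using fixed[of k] by simp
  moreover have False if "k < m"
  proof -
    obtain a where a: "?P a" "f a = Rung 0" using onto[of "Rung 0"] by (auto simp: ladder_def)
    obtain b where b: "?P b" "f b = Side" using onto[of Side] by auto
    have inc: "\<not> below a b" "\<not> below b a" using mono[of a b] mono[of b a] a b by auto
    have sees: "below c (Top k) \<and> (\<forall>j \<le> k. c \<noteq> Top j)" if c: "?P c" "f c \<in> {Rung 0, Side}" for c
    proof
      have "below (f c) (Top k)" using c(2) by auto
      then obtain d where "?P d" "below c d" "f d = Top k"
        using lift[OF c(1), of "Top k"] by auto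
      then show "below c (Top k)" using fixed[of k] by blast
      show "\<forall>j \<le> k. c \<noteq> Top j" using fixed c(2) by force
    qed
    \<comment> \<open>A non-top sees every top. If both are tops, their indices are at least
      \<open>k + 2\<close> and differ, so the larger one suffices.\<close>
    have "below a (Top (k + 1)) \<or> below b (Top (k + 1))"
      using sees[of a] sees[of b] a b inc
      by (cases a; cases b) (auto simp: ladder_def not_le)
    then have T: "?P (Top (k + 1))" using P_up a b that by auto
    have "f (Top (k + 1)) \<noteq> Top j" if "j \<le> k" for j
      using fixed[OF that] T that by fastforce
    \<comment> \<open>The image is not a top, hence below \<open>Top k\<close>, whose only preimage
      \<open>Top k\<close> is not above \<open>Top (k + 1)\<close>.\<close>
    then have "below (f (Top (k + 1))) (Top k)"
      using range[OF T] by (cases "f (Top (k + 1))") auto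
    then obtain d where "?P d" "below (Top (k + 1)) d" "f d = Top k"
      using lift[OF T, of "Top k"] by auto
    then have "below (Top (k + 1)) (Top k)" using fixed[of k] by blast
    then show False by (simp add: ladder_def)
  qed
  ultimately show ?thesis by fastforce
qed

section \<open>The degree of the logics of bounded width\<close>

text \<open>The formula \<open>bw n\<close> uses the variables up to \<open>n\<close> and the Jankov
  formula only later ones, so one valuation refutes both. By persistence a failure at
  \<open>x\<close> passes down to \<open>r\<close>, where \<open>bw n\<close> fails.\<close>

lemma Or_jankov_bw_refuted:
  fixes F :: "'a :: countable frame"
  assumes F: "is_poset F" and V: "\<forall>p. upset F (V p)"
    and r: "r \<in> fst F" "\<not> forces F V r (bw n)" and rx: "(r, x) \<in> snd F"
    and xs: "set xs = {y. (x, y) \<in> snd F}"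
  shows "\<not> valid F (Or (jankov (snd F) (\<lambda>a. Suc n + to_nat a) xs x) (bw n))"
proof -
  note P = is_posetD[OF F]
  define V' where
    "V' p = (if p \<le> n then V p else {y. (from_nat (p - Suc n), y) \<in> snd F})" for p
  have "upset F {y. (a, y) \<in> snd F}" for a
    unfolding upset_iff using P(2,5) by blast
  then have V': "\<forall>p. upset F (V' p)" using V by (simp add: V'_def)
  have "\<not> forces F V' r (bw n)"
    using r(2) unfolding not_forces_bw_iff[OF F] by (simp add: V'_def)
  moreover have "\<not> forces F V' x (jankov (snd F) (\<lambda>a. Suc n + to_nat a) xs x)"
    using P(5)[OF rx] xs by (intro jankov_refuted[OF F]) (simp_all add: V'_def)
  then have "\<not> forces F V' r (jankov (snd F) (\<lambda>a. Suc n + to_nat a) xs x)"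
    using forces_persistent[OF F V' rx] by blast
  ultimately show ?thesis
    unfolding valid_def using V' r(1) by auto
qed

lemma bw_refuted_in_tower:
  assumes "0 < N"
  shows "\<exists>V. (\<forall>p. upset (tower k N) (V p)) \<and> \<not> forces (tower k N) V Root (bw (N + 2))"
proof -
  \<comment> \<open>This lists the antichain of size \<open>N + 3\<close>; below, \<open>V i\<close>
    is the principal upset of \<open>s i\<close>.\<close>
  define s where
    "s i = (if i = 0 then Side else if i = 1 then Rung 0 else if i = 2 then Rung 1 else Extra (i - 3))"
    for i
  have s: "s i \<in> points k N" if "i \<le> N + 2" for i
    using that by (auto simp: s_def)
  have s_anti: "i = j" if "below (s i) (s j)" for i j
    using that by (auto simp: s_def ladder_def split: if_splits)
  define V where "V i = {a \<in> points k N. below (s i) a}" for i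
  have "upset (tower k N) (V p)" for p
    using below_trans by (auto simp: upset_iff V_def)
  moreover have "\<not> forces (tower k N) V Root (bw (N + 2))"
    unfolding not_forces_bw_iff[OF is_poset_tower]
  proof (intro allI impI exI conjI)
    show "(Root, s i) \<in> snd (tower k N)" "s i \<in> V i" if "i \<le> N + 2" for i
      using s[OF that] by (auto simp: V_def below_refl)
    show "s i \<notin> V j" if "j \<noteq> i" for i j
      using s_anti that by (auto simp: V_def)
  qed
  ultimately show ?thesis by blast
qed

section \<open>Logics of families of towers\<close>

text \<open>The shift by 2 makes the finite ladder long enough to be rigid.\<close>

definition tower_logic :: "nat \<Rightarrow> nat set \<Rightarrow> fm set" where
  "tower_logic n S = {A \<in> BW n. \<forall>i \<in> S. valid (tower (i + 2) (n - 2)) A}"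

lemma si_logic_tower_logic: "si_logic (tower_logic n S)"
proof -
  have "tower_logic n S = \<Inter> (insert (BW n) ((\<lambda>i. {A. valid (tower (i + 2) (n - 2)) A}) ` S))"
    by (auto simp: tower_logic_def)
  moreover have "si_logic L"
    if "L \<in> insert (BW n) ((\<lambda>i. {A. valid (tower (i + 2) (n - 2)) A}) ` S)" for L
    using that si_logic_BW si_logic_valid[OF is_poset_tower] by auto
  ultimately show ?thesis using si_logic_Inter by metis
qed

text \<open>If a finite \<open>F\<close> refutes \<open>bw n\<close> at \<open>x\<close>, the Jankov
  formula of the upset of \<open>x\<close> holds in every tower, since that upset is too wide to be
  an image. Its disjunction with \<open>bw n\<close> is then in the logic but fails in
  \<open>F\<close>.\<close>

lemma Fin_tower_logic:
  assumes n: "2 < n"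
  shows "Fin (tower_logic n S) = Fin (BW n)"
proof
  show "Fin (BW n) \<subseteq> Fin (tower_logic n S)"
    by (auto simp: Fin_def validates_def tower_logic_def)
  show "Fin (tower_logic n S) \<subseteq> Fin (BW n)"
  proof
    fix F
    assume "F \<in> Fin (tower_logic n S)"
    then have F: "is_poset F" "finite (fst F)" and val: "validates F (tower_logic n S)"
      by (auto simp: Fin_def)
    note P = is_posetD[OF F(1)]
    have "valid F (bw n)"
    proof (rule ccontr)
      assume "\<not> valid F (bw n)"
      then obtain V x where V: "\<forall>p. upset F (V p)" and x: "x \<in> fst F"
        and nf: "\<not> forces F V x (bw n)" unfolding valid_def by blast
      have "{y. (x, y) \<in> snd F} \<subseteq> fst F" using P(5) by blast
      then obtain xs where xs: "set xs = {y. (x, y) \<in> snd F}"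
        using F(2) finite_list finite_subset by metis
      define J where "J = jankov (snd F) (\<lambda>a. Suc n + to_nat a) xs x"
      obtain y where y: "\<And>i. i \<le> n \<Longrightarrow> (x, y i) \<in> snd F \<and> y i \<in> V i"
        and y': "\<And>i j. i \<le> n \<Longrightarrow> j \<le> n \<Longrightarrow> j \<noteq> i \<Longrightarrow> y i \<notin> V j"
        using nf unfolding not_forces_bw_iff[OF F(1)] by metis
      have anti: "i = j" if "i \<le> n" "j \<le> n" "(y i, y j) \<in> snd F" for i j
      proof (rule ccontr)
        assume "i \<noteq> j"
        moreover have "y j \<in> V i" using V y[OF that(1)] that(3) unfolding upset_iff by blast
        ultimately show False using y' that by blast
      qed
      have "valid (tower k (n - 2)) J" for k
      proof (rule ccontr)
        assume "\<not> valid (tower k (n - 2)) J"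
        then obtain h f where "h \<in> points k (n - 2)" "pmorphism (tower k (n - 2)) h F x f"
          using jankov_imp_pmorphism[OF is_poset_tower F(1) x xs] unfolding J_def by fastforce
        then show False
          using no_wide_finite_image[OF F, of "n - 2" h k x f y] n y anti by simp
      qed
      then have "valid (tower k (n - 2)) (Or J (bw n))" for k
        by (simp add: valid_def)
      then have "Or J (bw n) \<in> tower_logic n S"
        by (simp add: tower_logic_def Or_bw_in_BW)
      moreover have "\<not> valid F (Or J (bw n))"
        unfolding J_def using Or_jankov_bw_refuted[OF F(1) V x nf P(1)[OF x] xs] .
      ultimately show False using val by (auto simp: validates_def)
    qed
    then show "F \<in> Fin (BW n)" using F validates_BW_iff[OF F(1)] unfolding Fin_def by blast
  qed
qed

lemma tower_logic_separated:
  assumes n: "2 < n" and i: "i \<in> S" "i \<notin> T"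
  shows "tower_logic n S \<noteq> tower_logic n T"
proof -
  let ?G = "tower (i + 2) (n - 2)"
  \<comment> \<open>The upset of \<open>Rung 2\<close> is finite although the tower is not, so it
    has a Jankov formula.\<close>
  have "{y. (Rung 2, y) \<in> snd ?G} \<subseteq> {Rung 2, Rung 0, Side} \<union> Top ` {..i + 2}"
  proof
    fix y
    assume "y \<in> {y. (Rung 2, y) \<in> snd ?G}"
    then show "y \<in> {Rung 2, Rung 0, Side} \<union> Top ` {..i + 2}"
      by (cases y) (auto simp: ladder_def)
  qed
  then have "finite {y. (Rung 2, y) \<in> snd ?G}"
    by (rule finite_subset) simp
  then obtain xs where xs: "set xs = {y. (Rung 2, y) \<in> snd ?G}"
    using finite_list by metis
  define J where "J = jankov (snd ?G) (\<lambda>a. Suc n + to_nat a) xs (Rung 2)"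
  obtain V where V: "\<forall>p. upset ?G (V p)" "\<not> forces ?G V Root (bw n)"
    using bw_refuted_in_tower[of "n - 2" "i + 2"] n by (metis le_add_diff_inverse2 less_or_eq_imp_le zero_less_diff)
  have "\<not> valid ?G (Or J (bw n))"
    unfolding J_def using V xs by (intro Or_jankov_bw_refuted[OF is_poset_tower, where r = Root]) auto
  then have "Or J (bw n) \<notin> tower_logic n S" using i by (auto simp: tower_logic_def)
  moreover have "valid (tower (j + 2) (n - 2)) J" if "j \<noteq> i" for j
  proof (rule ccontr)
    assume "\<not> valid (tower (j + 2) (n - 2)) J"
    then obtain h f where hf: "h \<in> points (j + 2) (n - 2)"
      "pmorphism (tower (j + 2) (n - 2)) h ?G (Rung 2) f"
      using jankov_imp_pmorphism[OF is_poset_tower is_poset_tower _ xs] unfolding J_def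
      by fastforce
    have "j + 2 = i + 2"
      by (rule pmorphism_onto_tower_part[OF _ _ hf]) simp_all
    then show False using that by simp
  qed
  then have "valid (tower (j + 2) (n - 2)) (Or J (bw n))" if "j \<noteq> i" for j
    using that by (simp add: valid_def)
  then have "valid (tower (j + 2) (n - 2)) (Or J (bw n))" if "j \<in> T" for j
    using that i by metis
  then have "Or J (bw n) \<in> tower_logic n T"
    by (simp add: tower_logic_def Or_bw_in_BW)
  ultimately show ?thesis by blast
qed

section \<open>Counting the logics\<close>

instance fm :: countable by countable_datatype

lemma card_of_Pow_nat: "|UNIV :: nat set set| =o ctwo ^c natLeq"
  using card_of_Pow_Func[of "UNIV :: nat set"]
  by (simp add: cexp_def ctwo_def Field_natLeq Field_card_of)

theorem theorem6p1:
  fixes n :: nat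
  assumes "2 < n"
  shows "deg (BW n) =o BNF_Cardinal_Arithmetic.ctwo ^c natLeq"
proof -
  let ?D = "{L'. si_logic L' \<and> Fin L' = Fin (BW n)}"
  have "inj (tower_logic n)"
    \<comment> \<open>Distinct index sets differ in an element of one of them, and separation
      applies in either direction.\<close>
    by (rule injI) (metis tower_logic_separated[OF assms] set_eq_iff)
  moreover have "range (tower_logic n) \<subseteq> ?D"
    using si_logic_tower_logic Fin_tower_logic[OF assms] by blast
  ultimately have lower: "|UNIV :: nat set set| \<le>o |?D|"
    using card_of_ordLeq by blast
  have "inj (image (to_nat :: fm \<Rightarrow> nat))"
    by (simp add: inj_image_eq_iff inj_def)
  then have "inj_on (image (to_nat :: fm \<Rightarrow> nat)) ?D"
    by (rule inj_on_subset) simp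
  then have "|?D| \<le>o |UNIV :: nat set set|"
    using card_of_ordLeq by blast
  with lower have "|?D| =o |UNIV :: nat set set|"
    by (simp add: ordIso_iff_ordLeq)
  then show ?thesis
    unfolding deg_def using card_of_Pow_nat by (rule ordIso_transitive)
qed

end
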